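(* Let $p,q\in[1,+\infty)$, and let $E$ be a Banach space when $p=1$, or a normed space when $p>1$. Let $f\colon E\to E$ be such that the composition operator $C_f$ maps $bv_p(E)$ into $bv_q(E)$. Then $C_f\colon bv_p(E)\to bv_q(E)$ is continuous.
   Context: $E$ is over $\mathbb R$ or $\mathbb C$ with norm $\|\cdot\|$. For a map $f\colon E\to E$, the composition operator $C_f$ assigns to a sequence $x\colon\mathbb N\to E$ the sequence $C_f(x)$ with $C_f(x)(n)=f(x(n))$ for all $n\in\mathbb N$. For $p\in[1,+\infty)$, $bv_p(E)$ is the space of all sequences $x\colon\mathbb N\to E$ with $\sum_{n=1}^\infty\|x(n+1)-x(n)\|^p<+\infty$, with norm $\|x\|_{bv_p}=\|x(1)\|+\bigl(\sum_{n=1}^\infty\|x(n+1)-x(n)\|^p\bigr)^{1/p}$. *)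

theory Defs
  imports "HOL-Analysis.Analysis"
begin

text \<open>
  Sequences are indexed from 0 instead of 1; the initial value is \<open>x 0\<close>.  Complex normed
  spaces are covered by the class \<^class>\<open>real_normed_vector\<close>, because only differences and
  norms of vectors are used.
\<close>

definition comp_operator :: "('a \<Rightarrow> 'a) \<Rightarrow> (nat \<Rightarrow> 'a) \<Rightarrow> (nat \<Rightarrow> 'a)" where
  "comp_operator f x = (\<lambda>n. f (x n))"

definition bv_space :: "real \<Rightarrow> (nat \<Rightarrow> 'a::real_normed_vector) set" where
  "bv_space p = {x. summable (\<lambda>n. norm (x (Suc n) - x n) powr p)}"

definition bv_norm :: "real \<Rightarrow> (nat \<Rightarrow> 'a::real_normed_vector) \<Rightarrow> real" where
  "bv_norm p x = norm (x 0) + (\<Sum>n. norm (x (Suc n) - x n) powr p) powr (1 / p)"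

definition bv_dist :: "real \<Rightarrow> (nat \<Rightarrow> 'a::real_normed_vector) \<Rightarrow> (nat \<Rightarrow> 'a) \<Rightarrow> real" where
  "bv_dist p x y = bv_norm p (\<lambda>n. x n - y n)"

definition bv_topology :: "real \<Rightarrow> (nat \<Rightarrow> 'a::real_normed_vector) topology" where
  "bv_topology p = Metric_space.mtopology (bv_space p) (bv_dist p)"

text \<open>
  The constant \<open>Metric_space.mtopology\<close> is meaningful only for a genuine metric, which is
  established for \<^const>\<open>bv_dist\<close> below.
\<close>

lemma powr_convex_comb:
  fixes u v t p :: real
  assumes "1 \<le> p" "0 \<le> u" "0 \<le> v" "0 \<le> t" "t \<le> 1"
  shows "(t * u + (1 - t) * v) powr p \<le> t * u powr p + (1 - t) * v powr p"
proof -
  have shrink: "(s * w) powr p \<le> s * w powr p" if "0 \<le> s" "s \<le> 1" for s w :: real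
  proof -
    have "s powr p \<le> s"
      using powr_mono'[of 1 p s] assms(1) that by simp
    then show ?thesis
      using that by (cases "0 \<le> w") (auto simp: powr_mult intro!: mult_right_mono)
  qed
  show ?thesis
  proof (cases "u = 0 \<or> v = 0")
    case True
    then show ?thesis
      using shrink[of t u] shrink[of "1 - t" v] assms by auto
  next
    case False
    then show ?thesis
      using convex_onD[OF powr_convex[OF assms(1)], of "1 - t" u v] assms by simp
  qed
qed

lemma minkowski_series:
  fixes a b :: "nat \<Rightarrow> real" and p :: real
  assumes p: "1 \<le> p" and a: "\<And>n. 0 \<le> a n" and b: "\<And>n. 0 \<le> b n"
    and sa: "summable (\<lambda>n. a n powr p)" and sb: "summable (\<lambda>n. b n powr p)"
  shows "summable (\<lambda>n. (a n + b n) powr p)"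
    and "(\<Sum>n. (a n + b n) powr p) powr (1 / p)
      \<le> (\<Sum>n. a n powr p) powr (1 / p) + (\<Sum>n. b n powr p) powr (1 / p)"
proof -
  define A where "A = (\<Sum>n. a n powr p) powr (1 / p)"
  define B where "B = (\<Sum>n. b n powr p) powr (1 / p)"
  have Ap: "A powr p = (\<Sum>n. a n powr p)" and Bp: "B powr p = (\<Sum>n. b n powr p)"
    using p suminf_nonneg[OF sa] suminf_nonneg[OF sb] by (simp_all add: A_def B_def powr_powr)
  have *: "summable (\<lambda>n. (a n + b n) powr p) \<and> (\<Sum>n. (a n + b n) powr p) powr (1 / p) \<le> A + B"
  proof (cases "A = 0 \<or> B = 0")
    case True
    then show ?thesis
    proof
      assume "A = 0"
      then have "a n = 0" for n
        using Ap p suminf_eq_zero_iff[OF sa] by simp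
      then show ?thesis using sb \<open>A = 0\<close> by (simp add: B_def)
    next
      assume "B = 0"
      then have "b n = 0" for n
        using Bp p suminf_eq_zero_iff[OF sb] by simp
      then show ?thesis using sa \<open>B = 0\<close> by (simp add: A_def)
    qed
  next
    case False
    then have pos: "0 < A" "0 < B" by (auto simp: A_def B_def)
    define S where "S = A + B"
    have S: "0 < S" using pos by (simp add: S_def)
    define g where "g n = S powr p * (A / S * (a n powr p / A powr p) + B / S * (b n powr p / B powr p))" for n
    have le: "(a n + b n) powr p \<le> g n" for n
    proof -
      have t: "1 - A / S = B / S" using S by (simp add: S_def field_simps)
      have "A / S * (a n / A) + (1 - A / S) * (b n / B) = (a n + b n) / S"
        using pos S by (simp add: t add_divide_distrib)
      then have "((a n + b n) / S) powr p \<le> A / S * (a n / A) powr p + B / S * (b n / B) powr p"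
        using powr_convex_comb[of p "a n / A" "b n / B" "A / S"] p a b pos S
        unfolding t by (simp add: S_def)
      then show ?thesis
        using S a[of n] b[of n] pos by (simp add: g_def powr_divide field_simps)
    qed
    have "(\<lambda>n. A / S * (a n powr p / A powr p) + B / S * (b n powr p / B powr p)) sums
      (A / S * (A powr p / A powr p) + B / S * (B powr p / B powr p))"
      using sa sb unfolding Ap Bp
      by (intro sums_add sums_mult sums_divide summable_sums)
    then have "(\<lambda>n. A / S * (a n powr p / A powr p) + B / S * (b n powr p / B powr p)) sums 1"
      using pos S by (simp add: S_def flip: add_divide_distrib)
    then have g: "g sums (S powr p)"
      unfolding g_def using sums_mult[of _ 1 "S powr p"] by simp
    have sm: "summable (\<lambda>n. (a n + b n) powr p)"
      by (rule summable_comparison_test'[OF sums_summable[OF g], of 0]) (simp add: le)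
    have "(\<Sum>n. (a n + b n) powr p) \<le> S powr p"
      using suminf_le[OF le sm sums_summable[OF g]] sums_unique[OF g] by simp
    then have "(\<Sum>n. (a n + b n) powr p) powr (1 / p) \<le> (S powr p) powr (1 / p)"
      using p suminf_nonneg[OF sm] by (intro powr_mono2) simp_all
    also have "\<dots> = S" using p S by (simp add: powr_powr)
    finally show ?thesis using sm by (simp add: S_def)
  qed
  show "summable (\<lambda>n. (a n + b n) powr p)" using * ..
  show "(\<Sum>n. (a n + b n) powr p) powr (1 / p)
      \<le> (\<Sum>n. a n powr p) powr (1 / p) + (\<Sum>n. b n powr p) powr (1 / p)"
    using * by (simp add: A_def B_def)
qed

lemma bv_add:
  fixes x y :: "nat \<Rightarrow> 'a::real_normed_vector"
  assumes p: "1 \<le> p" and x: "x \<in> bv_space p" and y: "y \<in> bv_space p"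
  shows "(\<lambda>n. x n + y n) \<in> bv_space p"
    and "bv_norm p (\<lambda>n. x n + y n) \<le> bv_norm p x + bv_norm p y"
proof -
  let ?a = "\<lambda>n. norm (x (Suc n) - x n)" and ?b = "\<lambda>n. norm (y (Suc n) - y n)"
  let ?c = "\<lambda>n. norm (x (Suc n) + y (Suc n) - (x n + y n))"
  have M: "summable (\<lambda>n. (?a n + ?b n) powr p)"
    "(\<Sum>n. (?a n + ?b n) powr p) powr (1 / p)
      \<le> (\<Sum>n. ?a n powr p) powr (1 / p) + (\<Sum>n. ?b n powr p) powr (1 / p)"
    using minkowski_series[of p ?a ?b] p x y by (auto simp: bv_space_def)
  have le: "?c n powr p \<le> (?a n + ?b n) powr p" for n
    using p norm_triangle_ineq[of "x (Suc n) - x n" "y (Suc n) - y n"]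
    by (intro powr_mono2) (simp_all add: algebra_simps)
  have s: "summable (\<lambda>n. ?c n powr p)"
    by (rule summable_comparison_test'[OF M(1), of 0]) (simp add: le)
  then show "(\<lambda>n. x n + y n) \<in> bv_space p" by (simp add: bv_space_def)
  have "(\<Sum>n. ?c n powr p) powr (1 / p) \<le> (\<Sum>n. (?a n + ?b n) powr p) powr (1 / p)"
    using p suminf_le[OF le s M(1)] suminf_nonneg[OF s] by (intro powr_mono2) simp_all
  then show "bv_norm p (\<lambda>n. x n + y n) \<le> bv_norm p x + bv_norm p y"
    using M(2) norm_triangle_ineq[of "x 0" "y 0"] by (simp add: bv_norm_def)
qed

lemma bv_diff:
  fixes x y :: "nat \<Rightarrow> 'a::real_normed_vector"
  assumes p: "1 \<le> p" and x: "x \<in> bv_space p" and y: "y \<in> bv_space p"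
  shows "(\<lambda>n. x n - y n) \<in> bv_space p"
proof -
  have "(\<lambda>n. - y n) \<in> bv_space p"
    using y by (simp add: bv_space_def norm_minus_commute)
  then show ?thesis using bv_add(1)[OF p x] by fastforce
qed

lemma bv_norm_eq_0_iff:
  fixes x :: "nat \<Rightarrow> 'a::real_normed_vector"
  assumes p: "1 \<le> p" and x: "x \<in> bv_space p"
  shows "bv_norm p x = 0 \<longleftrightarrow> x = (\<lambda>n. 0)"
proof
  assume 0: "bv_norm p x = 0"
  have s: "summable (\<lambda>n. norm (x (Suc n) - x n) powr p)" using x by (simp add: bv_space_def)
  have z: "x 0 = 0" "(\<Sum>n. norm (x (Suc n) - x n) powr p) powr (1 / p) = 0"
    using 0 by (simp_all add: bv_norm_def add_nonneg_eq_0_iff)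
  then have "x (Suc n) = x n" for n
    using p suminf_eq_zero_iff[OF s] by simp
  then have "x n = 0" for n using z(1) by (induction n) auto
  then show "x = (\<lambda>n. 0)" by auto
qed (use p in \<open>simp add: bv_norm_def\<close>)

lemma Metric_space_bv:
  assumes p: "1 \<le> p"
  shows "Metric_space (bv_space p :: (nat \<Rightarrow> 'a::real_normed_vector) set) (bv_dist p)"
proof
  fix x y z :: "nat \<Rightarrow> 'a"
  show "0 \<le> bv_dist p x y" by (simp add: bv_dist_def bv_norm_def)
  have "norm (x (Suc n) - y (Suc n) - (x n - y n)) = norm (y (Suc n) - x (Suc n) - (y n - x n))" for n
    by (subst norm_minus_commute) (simp add: algebra_simps)
  then show "bv_dist p x y = bv_dist p y x"
    by (simp add: bv_dist_def bv_norm_def norm_minus_commute[of "x 0" "y 0"])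
  assume x: "x \<in> bv_space p" and y: "y \<in> bv_space p"
  show "bv_dist p x y = 0 \<longleftrightarrow> x = y"
    using bv_norm_eq_0_iff[OF p bv_diff[OF p x y]] by (auto simp: bv_dist_def fun_eq_iff)
  assume z: "z \<in> bv_space p"
  show "bv_dist p x z \<le> bv_dist p x y + bv_dist p y z"
    using bv_add(2)[OF p bv_diff[OF p x y] bv_diff[OF p y z]] by (simp add: bv_dist_def)
qed

end

theory Submission
  imports Defs
begin

text \<open>
  If \<open>C_f\<close> maps \<open>bv_p\<close> into \<open>bv_q\<close>, then \<open>f\<close> satisfies
  \<open>\<parallel>f u - f v\<parallel>\<^sup>q \<le> L \<parallel>u - v\<parallel>\<^sup>p\<close> for all close \<open>u, v\<close>: uniformly on \<open>E\<close> when \<open>p > 1\<close>,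
  near every point when \<open>p = 1\<close>.  Otherwise one oscillates between \<open>u\<^sub>k\<close> and \<open>v\<^sub>k\<close>, where the
  estimate fails with \<open>L = 2\<^sup>k\<close>, about \<open>2\<^sup>-\<^sup>k / \<parallel>u\<^sub>k - v\<^sub>k\<parallel>\<^sup>p\<close> times before moving on to \<open>u\<^sub>k\<^sub>+\<^sub>1\<close>.
  This gives a sequence in \<open>bv_p\<close> whose image is not in \<open>bv_q\<close>.  Moving on is cheap for \<open>p > 1\<close>
  because \<open>m\<close> equal steps along a segment of length \<open>d\<close> cost \<open>d\<^sup>p m\<^sup>1\<^sup>-\<^sup>p\<close>, and for \<open>p = 1\<close> because
  all the points cluster at one point.

  The estimate then controls the tails of the images of all sequences near a given \<open>x\<close> by the
  tails of the sequences themselves; for \<open>p = 1\<close> this needs the limit of \<open>x\<close>, hence completeness.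
  The remaining finitely many terms are handled by the continuity of \<open>f\<close>.
\<close>

section \<open>Variation of finite lists and of zigzags\<close>

fun variation :: "real \<Rightarrow> 'a::real_normed_vector list \<Rightarrow> real" where
  "variation p (a # b # xs) = norm (b - a) powr p + variation p (b # xs)"
| "variation p xs = 0"

lemma variation_append:
  "xs \<noteq> [] \<Longrightarrow> variation p (xs @ ys) = variation p xs + variation p (last xs # ys)"
  by (induction p xs rule: variation.induct) auto

lemma variation_conv_sum:
  "variation p xs = (\<Sum>i<length xs - 1. norm (xs ! Suc i - xs ! i) powr p)"
proof (induction p xs rule: variation.induct)
  case (1 p a b xs)
  then show ?case by (simp add: sum.lessThan_Suc_shift del: sum.lessThan_Suc)
qed auto

lemma variation_nonneg: "0 \<le> variation p xs"
  by (simp add: variation_conv_sum sum_nonneg)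

lemma last_zigzag: "last (u # concat (replicate m [v, u])) = u"
  by (induction m) auto

lemma variation_zigzag:
  "variation p (u # concat (replicate m [v, u])) = 2 * real m * norm (u - v) powr p"
  by (induction m) (auto simp: norm_minus_commute[of v u] algebra_simps)

lemma map_zigzag: "map f (concat (replicate m [v, u])) = concat (replicate m [f v, f u])"
  by (induction m) auto

section \<open>Sequences in \<open>bv_p\<close> whose images leave \<open>bv_q\<close>\<close>

text \<open>Block \<open>B k\<close> leads from \<open>a k\<close> to \<open>a (Suc k)\<close>, so
  the blocks can be chained after \<open>a 0\<close>, and listing \<open>a k\<close> in front of
  \<open>B k\<close> counts the step across each joint exactly once. The variation of the chain
  stays below \<open>suminf c\<close>, while that of its image gains at least 1 per block.\<close>

lemma concatenation_of_blocks:
  fixes f :: "'a::real_normed_vector \<Rightarrow> 'a" and a :: "nat \<Rightarrow> 'a" and B :: "nat \<Rightarrow> 'a list"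
  assumes ne: "\<And>k. B k \<noteq> []" and last: "\<And>k. last (B k) = a (Suc k)"
    and small: "\<And>k. variation p (a k # B k) \<le> c k" and c: "summable c"
    and big: "\<And>k. 1 \<le> variation q (map f (a k # B k))"
  obtains x where "x \<in> bv_space p" "comp_operator f x \<notin> bv_space q"
proof -
  define L where "L k = a 0 # concat (map B [0..<k])" for k
  have L_Suc: "L (Suc k) = L k @ B k" for k by (simp add: L_def)
  have L_ne: "L k \<noteq> []" for k by (simp add: L_def)
  have L_last: "last (L k) = a k" for k
    by (induction k) (simp add: L_def, simp add: L_Suc ne last)
  have L_len: "k < length (L k)" for k
  proof (induction k)
    case (Suc k)
    have "0 < length (B k)" using ne[of k] by simp
    then show ?case using Suc by (simp only: L_Suc length_append)
  qed (simp add: L_def)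
  have prefix: "n < length (L k) \<Longrightarrow> L (k + j) ! n = L k ! n \<and> n < length (L (k + j))" for n k j
    by (induction j) (auto simp: L_Suc nth_append)
  \<comment> \<open>A diagonal choice: \<open>L n\<close> has more than \<open>n\<close> entries,
    and the lists \<open>L k\<close> extend each other, so every sufficiently long
    \<open>L k\<close> gives the same value.\<close>
  define x where "x n = L n ! n" for n
  have x: "x n = L k ! n" if "n < length (L k)" for n k
    using prefix[OF that, of "n - k"] prefix[OF L_len[of n], of "k - n"]
    by (cases "k \<le> n") (auto simp: x_def)
  have sum_p: "(\<Sum>i<length (L k) - 1. norm (x (Suc i) - x i) powr p) = variation p (L k)" for k
    by (auto simp: variation_conv_sum x[of _ k] less_diff_conv intro!: sum.cong)
  have sum_q: "(\<Sum>i<length (L k) - 1. norm (f (x (Suc i)) - f (x i)) powr q)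
      = variation q (map f (L k))" for k
    by (auto simp: variation_conv_sum x[of _ k] less_diff_conv intro!: sum.cong)
  have c0: "0 \<le> c k" for k using small variation_nonneg order_trans by blast
  have "variation p (L k) \<le> (\<Sum>i<k. c i)" for k
  proof (induction k)
    case (Suc k)
    then show ?case using small[of k] by (simp add: L_Suc variation_append[OF L_ne] L_last)
  qed (simp add: L_def)
  then have p_le: "variation p (L k) \<le> suminf c" for k
    using sum_le_suminf[OF c, of "{..<k}"] c0 order_trans by blast
  have q_ge: "real k \<le> variation q (map f (L k))" for k
  proof (induction k)
    case (Suc k)
    have "variation q (map f (L (Suc k)))
        = variation q (map f (L k)) + variation q (map f (a k # B k))"
      using L_ne by (simp add: L_Suc variation_append last_map L_last)
    then show ?case using Suc big[of k] by simp
  qed (simp add: variation_nonneg)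
  have "summable (\<lambda>i. norm (x (Suc i) - x i) powr p)"
  proof (rule bounded_imp_summable)
    fix n
    have "(\<Sum>i\<le>n. norm (x (Suc i) - x i) powr p)
        \<le> (\<Sum>i<length (L (Suc n)) - 1. norm (x (Suc i) - x i) powr p)"
      using L_len[of "Suc n"] by (intro sum_mono2) auto
    then show "(\<Sum>i\<le>n. norm (x (Suc i) - x i) powr p) \<le> suminf c"
      using sum_p p_le by (metis order_trans)
  qed simp
  moreover have "\<not> summable (\<lambda>i. norm (f (x (Suc i)) - f (x i)) powr q)"
  proof
    assume s: "summable (\<lambda>i. norm (f (x (Suc i)) - f (x i)) powr q)"
    have "real k \<le> (\<Sum>i. norm (f (x (Suc i)) - f (x i)) powr q)" for k
      using q_ge[of k] sum_q[of k] sum_le_suminf[OF s, of "{..<length (L k) - 1}"] by simp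
    then show False by (metis reals_Archimedean2 not_less)
  qed
  ultimately show ?thesis
    by (intro that[of x]) (auto simp: bv_space_def comp_operator_def)
qed

lemma zigzag_contradiction:
  fixes f :: "'a::real_normed_vector \<Rightarrow> 'a" and u v :: "nat \<Rightarrow> 'a"
  assumes maps: "comp_operator f ` bv_space p \<subseteq> bv_space q"
    and close: "\<And>k. norm (u k - v k) powr p \<le> (1/2) ^ k"
    and steep: "\<And>k. 2 ^ k * norm (u k - v k) powr p < norm (f (u k) - f (v k)) powr q"
    and path: "\<And>k. \<exists>xs. xs \<noteq> [] \<and> last xs = u (Suc k) \<and> variation p (u k # xs) \<le> (1/2) ^ k"
  shows False
proof -
  obtain W where W: "W k \<noteq> []" "last (W k) = u (Suc k)" "variation p (u k # W k) \<le> (1/2) ^ k" for k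
    using path by metis
  define d where "d k = norm (u k - v k) powr p" for k
  \<comment> \<open>Strictness in \<open>steep\<close> excludes \<open>u k = v k\<close>, where both
    sides would be 0.\<close>
  have d: "0 < d k" for k using steep[of k] by (cases "u k = v k") (auto simp: d_def)
  \<comment> \<open>Rounding up keeps \<open>m k * d k\<close> at least \<open>(1/2) ^ k\<close>; it
    adds at most one \<open>d k\<close>, which \<open>close\<close> bounds by
    \<open>(1/2) ^ k\<close> again.\<close>
  define m where "m k = nat \<lceil>(1/2) ^ k / d k\<rceil>" for k
  have m: "(1/2) ^ k / d k \<le> real (m k)" "real (m k) \<le> (1/2) ^ k / d k + 1" for k
  proof -
    have "0 \<le> (1/2) ^ k / d k" using d[of k] by simp
    then show "(1/2) ^ k / d k \<le> real (m k)" "real (m k) \<le> (1/2) ^ k / d k + 1"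
      unfolding m_def by linarith+
  qed
  have m_ge: "(1/2) ^ k \<le> real (m k) * d k" and m_le: "real (m k) * d k \<le> 2 * (1/2) ^ k" for k
  proof -
    show "(1/2) ^ k \<le> real (m k) * d k" using m(1)[of k] d[of k] by (simp only: pos_divide_le_eq)
    have "real (m k) * d k \<le> ((1/2) ^ k / d k + 1) * d k"
      using m(2)[of k] d[of k] by (intro mult_right_mono) auto
    also have "\<dots> = (1/2) ^ k + d k" using d[of k] by (simp add: field_simps)
    finally show "real (m k) * d k \<le> 2 * (1/2) ^ k" using close[of k] by (simp add: d_def)
  qed
  define Z where "Z k = concat (replicate (m k) [v k, u k])" for k
  define B where "B k = Z k @ W k" for k
  \<comment> \<open>Stated for arbitrary \<open>g\<close>, so that one splitting serves the block
    itself (\<open>g\<close> the identity) and its image (\<open>g = f\<close>).\<close>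
  have var: "variation r (g (u k) # map g (B k)) = variation r (g (u k) # map g (Z k)) + variation r (g (u k) # map g (W k))"
    for r and g :: "'a \<Rightarrow> 'a" and k
    using variation_append[of "g (u k) # map g (Z k)" r "map g (W k)"]
      last_zigzag[of "g (u k)" "m k" "g (v k)"]
    by (simp add: B_def Z_def map_zigzag)
  obtain x where "x \<in> bv_space p" "comp_operator f x \<notin> bv_space q"
  proof (rule concatenation_of_blocks[of B u p "\<lambda>k. 5 * (1/2) ^ k" q f])
    fix k
    show "B k \<noteq> []" "last (B k) = u (Suc k)" by (simp_all add: B_def W)
    \<comment> \<open>The \<open>2 * m k\<close> zigzag steps cost at most
      \<open>4 * (1/2) ^ k\<close>, and the path \<open>W k\<close> at most
      \<open>(1/2) ^ k\<close>.\<close>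
    show "variation p (u k # B k) \<le> 5 * (1/2) ^ k"
      using var[of p "\<lambda>z. z" k] variation_zigzag[of p "u k" "m k" "v k"] W(3)[of k] m_le[of k]
      by (simp add: Z_def d_def)
    have "1 = 2 ^ k * (1/2::real) ^ k" by (simp flip: power_mult_distrib)
    also have "\<dots> \<le> 2 ^ k * (real (m k) * d k)" by (intro mult_left_mono m_ge) auto
    also have "\<dots> = real (m k) * (2 ^ k * d k)" by simp
    also have "\<dots> \<le> real (m k) * norm (f (u k) - f (v k)) powr q"
      using steep[of k] by (intro mult_left_mono) (auto simp: d_def)
    also have "\<dots> \<le> 2 * real (m k) * norm (f (u k) - f (v k)) powr q"
      by simp
    also have "\<dots> = variation q (f (u k) # map f (Z k))"
      by (simp add: Z_def map_zigzag variation_zigzag)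
    also have "\<dots> \<le> variation q (map f (u k # B k))"
      using var[of q f k] variation_nonneg[of q "f (u k) # map f (W k)"] by simp
    finally show "1 \<le> variation q (map f (u k # B k))" .
  qed (auto intro!: summable_mult summable_geometric)
  then show False using maps by blast
qed

section \<open>Uniform and local estimates for \<open>f\<close>\<close>

text \<open>The cost of \<open>m\<close> equal steps carries the factor
  \<open>m powr (1 - p)\<close>, which tends to 0 because the exponent is negative. For
  \<open>p = 1\<close> every path costs at least \<open>norm (b - a)\<close>.\<close>

lemma cheap_path:
  fixes a b :: "'a::real_normed_vector"
  assumes p: "1 < p" and e: "0 < e"
  shows "\<exists>xs. xs \<noteq> [] \<and> last xs = b \<and> variation p (a # xs) \<le> e"
proof -
  have "((\<lambda>m. real m powr (1 - p) * norm (b - a) powr p) \<longlongrightarrow> 0 * norm (b - a) powr p) sequentially"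
    using p by (intro tendsto_mult tendsto_neg_powr filterlim_real_sequentially tendsto_const) auto
  then have "\<forall>\<^sub>F m in sequentially. real m powr (1 - p) * norm (b - a) powr p < e"
    using e by (intro order_tendstoD(2)) auto
  then have "\<forall>\<^sub>F m in sequentially. real m powr (1 - p) * norm (b - a) powr p < e \<and> 0 < m"
    using eventually_gt_at_top eventually_conj by blast
  then obtain m where m: "real m powr (1 - p) * norm (b - a) powr p < e" "0 < m"
    using eventually_happens'[OF sequentially_bot] by blast
  define g where "g i = a + (real i / real m) *\<^sub>R (b - a)" for i
  define xs where "xs = map g [1..<Suc m]"
  have "a # xs = map g [0..<Suc m]"
    by (simp add: xs_def upt_conv_Cons g_def del: upt_Suc)
  then have "variation p (a # xs) = (\<Sum>i<m. norm (g (Suc i) - g i) powr p)"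
    by (simp add: variation_conv_sum del: upt_Suc)
  also have "\<dots> = (\<Sum>i<m. norm (b - a) powr p / real m powr p)"
  proof (rule sum.cong)
    fix i
    have "g (Suc i) - g i = (1 / real m) *\<^sub>R (b - a)"
      by (simp add: g_def add_divide_distrib algebra_simps flip: scaleR_left_diff_distrib)
    then show "norm (g (Suc i) - g i) powr p = norm (b - a) powr p / real m powr p"
      by (simp add: powr_divide)
  qed simp
  also have "\<dots> = real m powr (1 - p) * norm (b - a) powr p"
    using m(2) by (simp add: powr_diff)
  finally have "variation p (a # xs) \<le> e" using m by simp
  moreover have "xs \<noteq> []" "last xs = b"
    using m(2) by (simp_all add: xs_def g_def)
  ultimately show ?thesis by blast
qed

text \<open>Failure for \<delta> = \<open>(1/2) ^ k\<close> and \<open>L = 2 ^ k\<close> yields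
  steep pairs that may lie far apart in the space; \<open>cheap_path\<close> connects them.\<close>

lemma uniform_estimate:
  fixes f :: "'a::real_normed_vector \<Rightarrow> 'a"
  assumes maps: "comp_operator f ` bv_space p \<subseteq> bv_space q" and p: "1 < p"
  shows "\<exists>\<delta>>0. \<exists>L\<ge>0. \<forall>u v. norm (u - v) powr p \<le> \<delta> \<longrightarrow>
    norm (f u - f v) powr q \<le> L * norm (u - v) powr p"
proof (rule ccontr)
  assume neg: "\<not> ?thesis"
  have "\<exists>u v. norm (u - v) powr p \<le> (1/2) ^ k \<and>
      2 ^ k * norm (u - v) powr p < norm (f u - f v) powr q" for k :: nat
    using neg[simplified, rule_format, of "(1/2) ^ k" "2 ^ k"] by (force simp: not_le)
  then obtain u v where "norm (u k - v k) powr p \<le> (1/2) ^ k"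
      "2 ^ k * norm (u k - v k) powr p < norm (f (u k) - f (v k)) powr q" for k
    by metis
  then show False
    by (rule zigzag_contradiction[OF maps]) (auto intro!: cheap_path p)
qed

text \<open>Now the steep pairs converge to \<open>a\<close>, so a single direct step from
  \<open>u k\<close> to \<open>u (Suc k)\<close> is cheap enough for every
  \<open>p \<ge> 1\<close>.\<close>

lemma local_estimate:
  fixes f :: "'a::real_normed_vector \<Rightarrow> 'a"
  assumes maps: "comp_operator f ` bv_space p \<subseteq> bv_space q" and p: "1 \<le> p"
  shows "\<exists>\<delta>>0. \<exists>L\<ge>0. \<forall>u v. norm (u - a) < \<delta> \<longrightarrow> norm (v - a) < \<delta> \<longrightarrow>
    norm (f u - f v) powr q \<le> L * norm (u - v) powr p"
proof (rule ccontr)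
  assume neg: "\<not> ?thesis"
  \<comment> \<open>Half of \<open>(1/2) ^ k\<close> as radius makes any two points of the ball less
    than \<open>(1/2) ^ k\<close> apart.\<close>
  have "\<exists>u v. norm (u - a) < (1/2) ^ k / 2 \<and> norm (v - a) < (1/2) ^ k / 2 \<and>
      2 ^ k * norm (u - v) powr p < norm (f u - f v) powr q" for k :: nat
    using neg[simplified, rule_format, of "(1/2) ^ k / 2" "2 ^ k"] by (force simp: not_le)
  then obtain u v where near: "norm (u k - a) < (1/2) ^ k / 2" "norm (v k - a) < (1/2) ^ k / 2"
    and steep: "2 ^ k * norm (u k - v k) powr p < norm (f (u k) - f (v k)) powr q" for k
    by metis
  have pw: "norm z powr p \<le> (1/2) ^ k" if "norm z \<le> (1/2) ^ k" for z :: 'a and k :: nat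
  proof -
    have "(1/2::real) ^ k \<le> 1" by (simp add: power_le_one)
    then have "norm z powr p \<le> norm z"
      using powr_mono'[of 1 p "norm z"] p that by simp
    then show ?thesis using that by simp
  qed
  show False
  proof (rule zigzag_contradiction[OF maps _ steep])
    fix k
    have "norm (u k - v k) \<le> norm (u k - a) + norm (v k - a)"
      by norm
    then show "norm (u k - v k) powr p \<le> (1/2) ^ k"
      using near[of k] by (intro pw) linarith
    have "norm (u (Suc k) - u k) \<le> norm (u (Suc k) - a) + norm (u k - a)"
      by norm
    moreover have "(1/2::real) ^ Suc k \<le> (1/2) ^ k" by simp
    ultimately have "norm (u (Suc k) - u k) powr p \<le> (1/2) ^ k"
      using near(1)[of k] near(1)[of "Suc k"] by (intro pw) linarith
    then show "\<exists>xs. xs \<noteq> [] \<and> last xs = u (Suc k) \<and> variation p (u k # xs) \<le> (1/2) ^ k"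
      by (intro exI[of _ "[u (Suc k)]"]) simp
  qed
qed

section \<open>Terms and increments controlled by the norm of \<open>bv_p\<close>\<close>

lemma norm_diff_le_sum_increments:
  fixes x :: "nat \<Rightarrow> 'a::real_normed_vector"
  assumes "m \<le> n"
  shows "norm (x n - x m) \<le> (\<Sum>i=m..<n. norm (x (Suc i) - x i))"
  using norm_sum[of "\<lambda>i. x (Suc i) - x i" "{m..<n}"] sum_Suc_diff'[OF assms, of x] by simp

lemma increment_le_bv_norm:
  fixes x :: "nat \<Rightarrow> 'a::real_normed_vector"
  assumes p: "1 \<le> p" and x: "x \<in> bv_space p"
  shows "norm (x (Suc n) - x n) \<le> bv_norm p x"
    and "(\<Sum>i. norm (x (Suc i) - x i) powr p) \<le> bv_norm p x powr p"
proof -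
  let ?a = "\<lambda>i. norm (x (Suc i) - x i) powr p"
  have s: "summable ?a" using x by (simp add: bv_space_def)
  have le: "(\<Sum>i. ?a i) powr (1 / p) \<le> bv_norm p x" by (simp add: bv_norm_def)
  have "((\<Sum>i. ?a i) powr (1 / p)) powr p \<le> bv_norm p x powr p"
    using p le by (intro powr_mono2) auto
  then show *: "(\<Sum>i. ?a i) \<le> bv_norm p x powr p"
    using p suminf_nonneg[OF s] by (simp add: powr_powr)
  have "?a n \<le> (\<Sum>i. ?a i)" using sum_le_suminf[OF s, of "{n}"] by simp
  with * have "?a n \<le> bv_norm p x powr p" by linarith
  then show "norm (x (Suc n) - x n) \<le> bv_norm p x"
    using p powr_less_mono2[of p "bv_norm p x" "norm (x (Suc n) - x n)"]
    by (fastforce simp: bv_norm_def)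
qed

text \<open>The initial value and each of the \<open>n\<close> increments up to index
  \<open>n\<close> are bounded by the norm. The factor grows with \<open>n\<close>, so this serves
  for finitely many terms.\<close>

lemma norm_le_bv_norm:
  fixes x :: "nat \<Rightarrow> 'a::real_normed_vector"
  assumes p: "1 \<le> p" and x: "x \<in> bv_space p"
  shows "norm (x n) \<le> (real n + 1) * bv_norm p x"
proof (induction n)
  case 0
  then show ?case by (simp add: bv_norm_def)
next
  case (Suc n)
  have "norm (x (Suc n)) \<le> norm (x n) + norm (x (Suc n) - x n)" by norm
  then show ?case using Suc increment_le_bv_norm(1)[OF p x, of n] by (simp add: algebra_simps)
qed

text \<open>For \<open>p = 1\<close> the increments sum absolutely, so the bound is uniform in
  \<open>n\<close>; closeness in \<open>bv_1\<close> is therefore uniform closeness of all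
  terms.\<close>

lemma norm_le_bv_norm_1:
  fixes x :: "nat \<Rightarrow> 'a::real_normed_vector"
  assumes x: "x \<in> bv_space 1"
  shows "norm (x n) \<le> bv_norm 1 x"
proof -
  have s: "summable (\<lambda>i. norm (x (Suc i) - x i))" using x by (simp add: bv_space_def)
  have "norm (x n) \<le> norm (x 0) + norm (x n - x 0)" by norm
  also have "\<dots> \<le> norm (x 0) + (\<Sum>i. norm (x (Suc i) - x i))"
    using norm_diff_le_sum_increments[of 0 n x] sum_le_suminf[OF s, of "{0..<n}"] by simp
  finally show ?thesis using suminf_nonneg[OF s] by (simp add: bv_norm_def)
qed

lemma bv_1_convergent:
  fixes x :: "nat \<Rightarrow> 'a::real_normed_vector"
  assumes x: "x \<in> bv_space 1" and complete: "complete (UNIV :: 'a set)"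
  obtains a where "x \<longlonglongrightarrow> a"
proof -
  have s: "summable (\<lambda>i. norm (x (Suc i) - x i))" using x by (simp add: bv_space_def)
  have "Cauchy x"
  proof (rule CauchyI')
    fix e :: real assume e: "0 < e"
    obtain N where N: "\<And>m n. m \<ge> N \<Longrightarrow> norm (\<Sum>i=m..<n. norm (x (Suc i) - x i)) < e"
      using s e unfolding summable_Cauchy by blast
    have "dist (x m) (x n) < e" if "m \<ge> N" "m < n" for m n
      using norm_diff_le_sum_increments[of m n x] N[of m n] that by (simp add: dist_norm norm_minus_commute)
    then show "\<exists>M. \<forall>m\<ge>M. \<forall>n>m. dist (x m) (x n) < e" by blast
  qed
  then show ?thesis using complete that by (auto simp: complete_def)
qed

section \<open>Tails, heads and continuity of \<open>f\<close>\<close>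

text \<open>The point is that \<open>L\<close> and \<open>N\<close> are common to all
  \<open>y\<close> near \<open>x\<close>. For \<open>p = 1\<close>, uniform closeness puts the tail
  of \<open>y\<close> into the ball around the limit of \<open>x\<close> where the local estimate
  holds. For \<open>p > 1\<close> the uniform estimate asks only for small increments, and those of
  \<open>y\<close> differ little from those of \<open>x\<close>, which tend to 0.\<close>

lemma tail_estimate:
  fixes f :: "'a::real_normed_vector \<Rightarrow> 'a"
  assumes maps: "comp_operator f ` bv_space p \<subseteq> bv_space q" and p: "1 \<le> p"
    and complete: "p = 1 \<Longrightarrow> complete (UNIV :: 'a set)"
    and x: "x \<in> bv_space p"
  shows "\<exists>\<delta>>0. \<exists>L\<ge>0. \<exists>N. \<forall>y\<in>bv_space p. bv_dist p x y < \<delta> \<longrightarrow>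
    (\<forall>n\<ge>N. norm (f (y (Suc n)) - f (y n)) powr q \<le> L * norm (y (Suc n) - y n) powr p)"
proof (cases "p = 1")
  case True
  obtain a where a: "x \<longlonglongrightarrow> a"
    using bv_1_convergent x complete True by blast
  obtain \<delta> L where \<delta>: "0 < \<delta>" "0 \<le> L" and est: "\<And>u v. norm (u - a) < \<delta> \<Longrightarrow> norm (v - a) < \<delta> \<Longrightarrow>
      norm (f u - f v) powr q \<le> L * norm (u - v) powr p"
    using local_estimate[OF maps p, of a] by blast
  obtain N where N: "\<And>n. n \<ge> N \<Longrightarrow> norm (x n - a) < \<delta> / 2"
    using LIMSEQ_D[OF a, of "\<delta> / 2"] \<delta> by auto
  have "norm (f (y (Suc n)) - f (y n)) powr q \<le> L * norm (y (Suc n) - y n) powr p"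
    if y: "y \<in> bv_space p" "bv_dist p x y < \<delta> / 2" and n: "n \<ge> N" for y n
  proof (rule est)
    have "norm (y i - a) < \<delta>" if "i \<ge> N" for i
    proof -
      have "norm (x i - y i) < \<delta> / 2"
        using norm_le_bv_norm_1[of "\<lambda>n. x n - y n" i] bv_diff[OF p x y(1)] y(2) True
        by (simp add: bv_dist_def)
      moreover have "norm (y i - a) \<le> norm (x i - y i) + norm (x i - a)" by norm
      ultimately show ?thesis using N[OF that] by linarith
    qed
    then show "norm (y (Suc n) - a) < \<delta>" "norm (y n - a) < \<delta>" using n by simp_all
  qed
  then show ?thesis using \<delta> by (intro exI[of _ "\<delta> / 2"] conjI exI[of _ L] exI[of _ N]) auto
next
  case False
  then obtain \<delta> L where \<delta>: "0 < \<delta>" "0 \<le> L" and est: "\<And>u v. norm (u - v) powr p \<le> \<delta> \<Longrightarrow>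
      norm (f u - f v) powr q \<le> L * norm (u - v) powr p"
    using uniform_estimate[OF maps] p by force
  \<comment> \<open>\<open>r\<close> turns the condition on the \<open>p\<close>-th power into one
    on the norm. Half of it is for the increment of \<open>x\<close>, half for that of
    \<open>x - y\<close>.\<close>
  define r where "r = \<delta> powr (1 / p)"
  have r: "0 < r" "r powr p = \<delta>" using \<delta> p by (simp_all add: r_def powr_powr)
  have "(\<lambda>n. norm (x (Suc n) - x n) powr p) \<longlonglongrightarrow> 0"
    using x summable_LIMSEQ_zero by (auto simp: bv_space_def)
  then have "\<forall>\<^sub>F n in sequentially. norm (x (Suc n) - x n) powr p < (r / 2) powr p"
    using r by (intro order_tendstoD(2)) auto
  then obtain N where N: "\<And>n. n \<ge> N \<Longrightarrow> norm (x (Suc n) - x n) powr p < (r / 2) powr p"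
    by (auto simp: eventually_sequentially)
  have "norm (f (y (Suc n)) - f (y n)) powr q \<le> L * norm (y (Suc n) - y n) powr p"
    if y: "y \<in> bv_space p" "bv_dist p x y < r / 2" and n: "n \<ge> N" for y n
  proof (rule est)
    have "norm (x (Suc n) - x n) < r / 2"
      using N[OF n] powr_mono2[of p "r / 2" "norm (x (Suc n) - x n)"] p r by fastforce
    moreover have "norm ((x (Suc n) - y (Suc n)) - (x n - y n)) < r / 2"
      using increment_le_bv_norm(1)[OF p bv_diff[OF p x y(1)], of n] y(2) by (simp add: bv_dist_def)
    moreover have "norm (y (Suc n) - y n) \<le> norm (x (Suc n) - x n) + norm ((x (Suc n) - y (Suc n)) - (x n - y n))"
      by norm
    ultimately have "norm (y (Suc n) - y n) \<le> r" by linarith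
    then show "norm (y (Suc n) - y n) powr p \<le> \<delta>"
      using p powr_mono2[of p "norm (y (Suc n) - y n)" r] r by simp
  qed
  then show ?thesis using \<delta> r by (intro exI[of _ "r / 2"] conjI exI[of _ L] exI[of _ N]) auto
qed

lemma finitely_many_values_close:
  fixes f :: "'a::real_normed_vector \<Rightarrow> 'a"
  assumes p: "1 \<le> p" and x: "x \<in> bv_space p" and f: "\<And>a. isCont f a" and e: "0 < e"
  shows "\<exists>\<delta>>0. \<forall>y\<in>bv_space p. bv_dist p x y < \<delta> \<longrightarrow> (\<forall>n\<le>M. norm (f (x n) - f (y n)) < e)"
proof -
  have "\<exists>\<delta>>0. \<forall>z. norm (x n - z) < \<delta> \<longrightarrow> norm (f (x n) - f z) < e" for n
    using f[of "x n"] e unfolding continuous_at_eps_delta dist_norm by (metis norm_minus_commute)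
  then obtain d where d: "\<And>n. 0 < d n" "\<And>n z. norm (x n - z) < d n \<Longrightarrow> norm (f (x n) - f z) < e"
    by metis
  \<comment> \<open>The divisor \<open>real n + 1\<close> offsets the factor in
    \<open>norm_le_bv_norm\<close>.\<close>
  define \<delta> where "\<delta> = Min ((\<lambda>n. d n / (real n + 1)) ` {..M})"
  have "0 < \<delta>" using d(1) by (simp add: \<delta>_def)
  moreover have "norm (f (x n) - f (y n)) < e"
    if y: "y \<in> bv_space p" "bv_dist p x y < \<delta>" and n: "n \<le> M" for y n
  proof (rule d(2))
    have "norm (x n - y n) \<le> (real n + 1) * bv_dist p x y"
      using norm_le_bv_norm[OF p bv_diff[OF p x y(1)]] by (simp add: bv_dist_def)
    also have "\<dots> < (real n + 1) * \<delta>" using y(2) by (intro mult_strict_left_mono) auto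
    also have "\<dots> \<le> (real n + 1) * (d n / (real n + 1))"
      using n by (intro mult_left_mono) (auto simp: \<delta>_def)
    also have "\<dots> = d n" by simp
    finally show "norm (x n - y n) < d n" .
  qed
  ultimately show ?thesis by blast
qed

lemma norm_diff_powr_le:
  fixes a b :: "'a::real_normed_vector"
  assumes "0 \<le> p"
  shows "norm (a - b) powr p \<le> 2 powr p * (norm a powr p + norm b powr p)"
proof -
  have "norm (a - b) \<le> 2 * max (norm a) (norm b)"
    using norm_triangle_ineq4[of a b] by linarith
  then have "norm (a - b) powr p \<le> (2 * max (norm a) (norm b)) powr p"
    using assms by (intro powr_mono2) auto
  also have "\<dots> = 2 powr p * max (norm a) (norm b) powr p"
    by (simp add: powr_mult)
  also have "\<dots> \<le> 2 powr p * (norm a powr p + norm b powr p)"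
    by (intro mult_left_mono) (auto simp: max_def)
  finally show ?thesis .
qed

text \<open>This is the local estimate with one of the two points fixed at \<open>a\<close>.\<close>

lemma isCont_of_maps:
  fixes f :: "'a::real_normed_vector \<Rightarrow> 'a"
  assumes maps: "comp_operator f ` bv_space p \<subseteq> bv_space q" and p: "1 \<le> p" and q: "1 \<le> q"
  shows "isCont f a"
  unfolding continuous_at_eps_delta
proof (intro allI impI)
  fix e :: real assume e: "0 < e"
  obtain \<delta> L where \<delta>: "0 < \<delta>" "0 \<le> L" and est: "\<And>u v. norm (u - a) < \<delta> \<Longrightarrow> norm (v - a) < \<delta> \<Longrightarrow>
      norm (f u - f v) powr q \<le> L * norm (u - v) powr p"
    using local_estimate[OF maps p, of a] by blast
  \<comment> \<open>Chosen to make \<open>L * r powr p\<close> less than \<open>e powr q\<close>;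
    \<open>L + 1\<close> gives strictness and allows \<open>L = 0\<close>.\<close>
  define r where "r = (e powr q / (L + 1)) powr (1 / p)"
  have r: "0 < r" "r powr p = e powr q / (L + 1)"
    using e \<delta> p by (simp_all add: r_def powr_powr)
  have "norm (f z - f a) < e" if z: "norm (z - a) < min \<delta> r" for z
  proof -
    have "norm (f z - f a) powr q \<le> L * norm (z - a) powr p" using est[of z a] z \<delta> by simp
    also have "\<dots> \<le> L * r powr p" using z p \<delta> by (intro mult_left_mono powr_mono2) auto
    also have "\<dots> = e powr q * (L / (L + 1))" by (simp add: r)
    also have "\<dots> < e powr q * 1" using e \<delta> by (intro mult_strict_left_mono) auto
    finally show ?thesis
      using powr_mono2[of q e "norm (f z - f a)"] e q by fastforce
  qed
  then show "\<exists>d>0. \<forall>z. dist z a < d \<longrightarrow> dist (f z) (f a) < e"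
    using \<delta> r by (intro exI[of _ "min \<delta> r"]) (simp add: dist_norm)
qed

section \<open>Continuity of the composition operator at a point\<close>

lemma comp_operator_continuous_at:
  fixes f :: "'a::real_normed_vector \<Rightarrow> 'a"
  assumes p: "1 \<le> p" and q: "1 \<le> q"
    and complete: "p = 1 \<Longrightarrow> complete (UNIV :: 'a set)"
    and maps: "comp_operator f ` bv_space p \<subseteq> bv_space q"
    and x: "x \<in> bv_space p" and e: "0 < e"
  shows "\<exists>\<delta>>0. \<forall>y\<in>bv_space p. bv_dist p x y < \<delta> \<longrightarrow>
    bv_dist q (comp_operator f x) (comp_operator f y) < e"
proof -
  let ?dx = "\<lambda>n. norm (x (Suc n) - x n) powr p"
  obtain \<delta>1 L N where \<delta>1: "0 < \<delta>1" "0 \<le> L" and tail: "\<And>y n. y \<in> bv_space p \<Longrightarrow> bv_dist p x y < \<delta>1 \<Longrightarrow>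
      n \<ge> N \<Longrightarrow> norm (f (y (Suc n)) - f (y n)) powr q \<le> L * norm (y (Suc n) - y n) powr p"
    using tail_estimate[OF maps p complete x] by blast
  \<comment> \<open>Half of \<open>e\<close> is reserved for the initial value. The other half is
    left to the series, which must stay below \<sigma>: at most a third comes from the indices below
    \<open>M\<close> and a third from the rest.\<close>
  define \<sigma> where "\<sigma> = (e / 2) powr q"
  have \<sigma>: "0 < \<sigma>" "\<sigma> powr (1 / q) = e / 2" using e q by (simp_all add: \<sigma>_def powr_powr)
  \<comment> \<open>\<open>K - 1\<close> is the factor that arises in \<open>g_le\<close>; adding 1
    makes \<open>K\<close> positive, so that division by it is possible.\<close>
  define K where "K = 2 powr q * (L * (2 powr p + 1)) + 1"
  have K: "0 < K" using \<delta>1 by (simp add: K_def add_nonneg_pos)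
  \<comment> \<open>The tails of \<open>?dx\<close> and \<open>?h\<close> are each kept within
    \<eta>, so the image tail is at most \<open>K * (2 * \<eta>) = \<sigma> / 3\<close>.\<close>
  define \<eta> where "\<eta> = \<sigma> / (6 * K)"
  have \<eta>: "0 < \<eta>" using \<sigma> K by (simp add: \<eta>_def)
  have sx: "summable ?dx" using x by (simp add: bv_space_def)
  obtain N' where N': "\<And>n. n \<ge> N' \<Longrightarrow> norm (\<Sum>i. ?dx (i + n)) < \<eta>"
    using suminf_exist_split[OF \<eta> sx] by blast
  define M where "M = max N N'"
  have M: "N \<le> M" "(\<Sum>i. ?dx (i + M)) < \<eta>" using N'[of M] by (auto simp: M_def)
  \<comment> \<open>Each of the \<open>M\<close> head terms will be at most
    \<open>(2 * \<kappa>) powr q\<close>; \<open>M + 1\<close> allows \<open>M = 0\<close>.\<close>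
  define \<kappa> where "\<kappa> = (\<sigma> / (3 * (real M + 1))) powr (1 / q) / 2"
  have \<kappa>: "0 < \<kappa>" "(2 * \<kappa>) powr q = \<sigma> / (3 * (real M + 1))"
    using \<sigma> q by (simp_all add: \<kappa>_def powr_powr)
  have min_pos: "0 < min \<kappa> (e / 2)" using \<kappa> e by simp
  obtain \<delta>2 where \<delta>2: "0 < \<delta>2" and head: "\<And>y n. y \<in> bv_space p \<Longrightarrow> bv_dist p x y < \<delta>2 \<Longrightarrow> n \<le> M \<Longrightarrow>
      norm (f (x n) - f (y n)) < min \<kappa> (e / 2)"
    using finitely_many_values_close[OF p x isCont_of_maps[OF maps p q], of "min \<kappa> (e / 2)" M]
      min_pos by blast
  define \<delta>3 where "\<delta>3 = \<eta> powr (1 / p)"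
  have \<delta>3: "0 < \<delta>3" "\<delta>3 powr p = \<eta>" using \<eta> p by (simp_all add: \<delta>3_def powr_powr)
  have "bv_dist q (comp_operator f x) (comp_operator f y) < e"
    if y: "y \<in> bv_space p" and "bv_dist p x y < min \<delta>1 (min \<delta>2 \<delta>3)" for y
  proof -
    have d: "bv_dist p x y < \<delta>1" "bv_dist p x y < \<delta>2" "bv_dist p x y < \<delta>3" using that by auto
    have xy: "(\<lambda>n. x n - y n) \<in> bv_space p" by (rule bv_diff[OF p x y])
    let ?g = "\<lambda>n. norm (f (x (Suc n)) - f (y (Suc n)) - (f (x n) - f (y n))) powr q"
    let ?h = "\<lambda>n. norm (x (Suc n) - y (Suc n) - (x n - y n)) powr p"
    have sh: "summable ?h" using xy by (simp add: bv_space_def)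
    have "(\<Sum>n. ?h n) \<le> bv_dist p x y powr p"
      using increment_le_bv_norm(2)[OF p xy] by (simp add: bv_dist_def)
    also have "\<dots> \<le> \<delta>3 powr p"
      using d(3) p by (intro powr_mono2) (auto simp: bv_dist_def bv_norm_def)
    finally have h: "(\<Sum>n. ?h n) \<le> \<eta>" using \<delta>3 by simp
    have h_tail: "(\<Sum>n. ?h (n + M)) \<le> \<eta>"
      using h suminf_split_initial_segment[OF sh, of M] sum_nonneg[of "{..<M}" ?h] by simp
    have "(\<lambda>n. comp_operator f x n - comp_operator f y n) \<in> bv_space q"
      using maps x y by (intro bv_diff q) auto
    then have sg: "summable ?g" by (simp add: bv_space_def comp_operator_def)
    \<comment> \<open>No cancellation between \<open>f (x n)\<close> and \<open>f (y n)\<close> is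
      sought: in the tail the image increments of \<open>x\<close> and of \<open>y\<close> are each
      small. Those of \<open>y\<close> are traced back to \<open>?dx\<close> and
      \<open>?h\<close>.\<close>
    have g_le: "?g n \<le> K * (?dx n + ?h n)" if n: "n \<ge> M" for n
    proof -
      have dy: "norm (y (Suc n) - y n) powr p \<le> 2 powr p * (?dx n + ?h n)"
        using norm_diff_powr_le[of p "x (Suc n) - x n" "x (Suc n) - y (Suc n) - (x n - y n)"] p
        by (simp add: algebra_simps)
      have "?g n \<le> 2 powr q * (norm (f (x (Suc n)) - f (x n)) powr q + norm (f (y (Suc n)) - f (y n)) powr q)"
        using norm_diff_powr_le[of q "f (x (Suc n)) - f (x n)" "f (y (Suc n)) - f (y n)"] q
        by (simp add: algebra_simps)
      also have "\<dots> \<le> 2 powr q * (L * ?dx n + L * norm (y (Suc n) - y n) powr p)"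
      proof (intro mult_left_mono add_mono)
        \<comment> \<open>\<open>x\<close> is itself one of the sequences near \<open>x\<close>, so
          \<open>tail\<close> applies to it too.\<close>
        have "bv_dist p x x < \<delta>1" using \<delta>1 p by (simp add: bv_dist_def bv_norm_def)
        then show "norm (f (x (Suc n)) - f (x n)) powr q \<le> L * ?dx n"
          using tail[OF x] n M by simp
        show "norm (f (y (Suc n)) - f (y n)) powr q \<le> L * norm (y (Suc n) - y n) powr p"
          using tail[OF y d(1)] n M by simp
      qed simp
      also have "\<dots> \<le> 2 powr q * (L * (?dx n + ?h n) + L * (2 powr p * (?dx n + ?h n)))"
        using \<delta>1 dy by (intro mult_left_mono add_mono) auto
      also have "\<dots> = (K - 1) * (?dx n + ?h n)" by (simp add: K_def algebra_simps)
      also have "\<dots> \<le> K * (?dx n + ?h n)" by (intro mult_right_mono) auto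
      finally show ?thesis .
    qed
    have sx': "summable (\<lambda>n. ?dx (n + M))" and sh': "summable (\<lambda>n. ?h (n + M))"
      and sg': "summable (\<lambda>n. ?g (n + M))"
      using summable_ignore_initial_segment[OF sx, of M] summable_ignore_initial_segment[OF sh, of M]
        summable_ignore_initial_segment[OF sg, of M] by simp_all
    have "(\<Sum>n. ?g (n + M)) \<le> (\<Sum>n. K * (?dx (n + M) + ?h (n + M)))"
      using g_le by (intro suminf_le sg' summable_mult summable_add sx' sh') auto
    also have "\<dots> = K * ((\<Sum>n. ?dx (n + M)) + (\<Sum>n. ?h (n + M)))"
      using sx' sh' by (simp only: suminf_mult suminf_add summable_add)
    also have "\<dots> \<le> K * (2 * \<eta>)"
      using M(2) h_tail K by (intro mult_left_mono) auto
    also have "\<dots> = \<sigma> / 3" using K by (simp add: \<eta>_def)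
    finally have tail_le: "(\<Sum>n. ?g (n + M)) \<le> \<sigma> / 3" .
    have "(\<Sum>n<M. ?g n) \<le> (\<Sum>n<M. (2 * \<kappa>) powr q)"
    proof (rule sum_mono)
      fix n assume "n \<in> {..<M}"
      then have "norm (f (x (Suc n)) - f (y (Suc n))) < \<kappa>" "norm (f (x n) - f (y n)) < \<kappa>"
        \<comment> \<open>The term at \<open>n = M - 1\<close> involves index \<open>M\<close>,
          hence the non-strict bound \<open>n \<le> M\<close> in \<open>head\<close>.\<close>
        using head[OF y d(2), of "Suc n"] head[OF y d(2), of n] by auto
      then have "norm (f (x (Suc n)) - f (y (Suc n)) - (f (x n) - f (y n))) \<le> 2 * \<kappa>"
        using norm_triangle_ineq4[of "f (x (Suc n)) - f (y (Suc n))" "f (x n) - f (y n)"] by linarith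
      then show "?g n \<le> (2 * \<kappa>) powr q" using q by (intro powr_mono2) auto
    qed
    also have "\<dots> = \<sigma> / 3 * (real M / (real M + 1))" by (simp add: \<kappa>)
    also have "\<dots> \<le> \<sigma> / 3 * 1" using \<sigma> by (intro mult_left_mono) auto
    finally have head_le: "(\<Sum>n<M. ?g n) \<le> \<sigma> / 3" by simp
    have "(\<Sum>n. ?g n) < \<sigma>"
      using suminf_split_initial_segment[OF sg, of M] tail_le head_le \<sigma> by simp
    then have "(\<Sum>n. ?g n) powr (1 / q) < e / 2"
      using powr_less_mono2[of "1 / q" "\<Sum>n. ?g n" \<sigma>] suminf_nonneg[OF sg] q \<sigma>(2) by simp
    then show ?thesis
      using head[OF y d(2), of 0] by (simp add: bv_dist_def bv_norm_def comp_operator_def)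
  qed
  moreover have "0 < min \<delta>1 (min \<delta>2 \<delta>3)" using \<delta>1 \<delta>2 \<delta>3 by simp
  ultimately show ?thesis by blast
qed

theorem theorem11:
  fixes p q :: real and f :: "'a::real_normed_vector \<Rightarrow> 'a"
  assumes "1 \<le> p" and "1 \<le> q"
    and "p = 1 \<Longrightarrow> complete (UNIV :: 'a set)"
    and "comp_operator f ` bv_space p \<subseteq> bv_space q"
  shows "continuous_map (bv_topology p) (bv_topology q) (comp_operator f)"
proof -
  interpret P: Metric_space "bv_space p :: (nat \<Rightarrow> 'a) set" "bv_dist p"
    by (rule Metric_space_bv[OF assms(1)])
  have "\<exists>\<delta>>0. \<forall>y. y \<in> bv_space p \<and> bv_dist p x y < \<delta> \<longrightarrow>
      bv_dist q (comp_operator f x) (comp_operator f y) < e"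
    if "x \<in> bv_space p" "0 < e" for x e
    using comp_operator_continuous_at[OF assms that] by metis
  then show ?thesis
    unfolding bv_topology_def P.metric_continuous_map[OF Metric_space_bv[OF assms(2)]]
    using assms(4) by simp
qed

end
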